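(* For every positive integer $n$, $$\sum_{k=0}^{n-1}\frac{1}{1+2\sin^2\!\left(\frac{k\pi}{n}\right)}=\frac{n}{\sqrt{3}}\left[\frac{2}{1-(2-\sqrt{3})^{n}}-1\right].$$ *)

theory Defs
  imports Complex_Main
begin

end

theory Submission
  imports Defs
begin

text \<open>
  With \<open>a = 2 - sqrt 3\<close>, a root of \<open>a\<^sup>2 - 4 a + 1\<close>, and \<open>w = cis (2 k pi / n)\<close>, the \<open>k\<close>-th
  summand is a multiple of the Poisson kernel at an \<open>n\<close>-th root of unity:
  \<open>sqrt 3 / (1 + 2 sin\<^sup>2 (k pi / n)) = (1 - a\<^sup>2) / |1 - a w|\<^sup>2 = 2 Re (1 / (1 - a w)) - 1\<close>.
  Since \<open>w ^ n = 1\<close>, the function \<open>1 / (1 - a w)\<close> is a finite geometric sum divided by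
  \<open>1 - a ^ n\<close>, and summing over all roots of unity only its constant term survives.
\<close>

text \<open>Writing w_k for the k-th root, w_k ^ j = w_j ^ k by symmetry of the angle in j and k.
  For 0 < j < n the sum is thus geometric with ratio w_j, and w_j differs from w_0 = 1 because the
  roots are distinct.\<close>

lemma sum_power_root_unity:
  fixes j n :: nat
  assumes "j < n"
  shows "(\<Sum>k<n. cis (2 * pi * real k / real n) ^ j) = (if j = 0 then of_nat n else 0)"
proof (cases "j = 0")
  case False
  let ?\<omega> = "\<lambda>k. cis (2 * pi * real k / real n)"
  have "inj_on ?\<omega> {..<n}"
    using bij_betw_roots_unity[of n] assms by (auto simp: bij_betw_def)
  then have "?\<omega> j \<noteq> ?\<omega> 0"
    using assms False by (auto dest: inj_onD[where x = j and y = 0])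
  then have ne: "?\<omega> j \<noteq> 1" by simp
  have "?\<omega> j ^ n = 1"
    using assms by (simp add: DeMoivre cis_multiple_2pi)
  then have "(\<Sum>k<n. ?\<omega> j ^ k) = 0"
    using ne by (simp add: sum_gp_strict)
  moreover have "?\<omega> k ^ j = ?\<omega> j ^ k" for k
    by (simp add: DeMoivre mult_ac)
  ultimately show ?thesis using False by simp
qed simp

lemma sum_inverse_one_minus_root_unity:
  fixes a :: complex and n :: nat
  assumes "n > 0" and "a ^ n \<noteq> 1"
  shows "(\<Sum>k<n. 1 / (1 - a * cis (2 * pi * real k / real n))) = of_nat n / (1 - a ^ n)"
proof -
  let ?\<omega> = "\<lambda>k. cis (2 * pi * real k / real n)"
  have geom: "1 / (1 - a * ?\<omega> k) = (\<Sum>j<n. (a * ?\<omega> k) ^ j) / (1 - a ^ n)" for k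
  proof -
    have "?\<omega> k ^ n = 1"
      using assms(1) by (simp add: DeMoivre cis_multiple_2pi)
    then have pow: "(a * ?\<omega> k) ^ n = a ^ n" by (simp add: power_mult_distrib)
    \<comment> \<open>Otherwise \<open>pow\<close> would give a ^ n = 1.\<close>
    then have "a * ?\<omega> k \<noteq> 1" using assms(2) by (metis power_one)
    then show ?thesis using assms(2) pow by (simp add: sum_gp_strict)
  qed
  have "(\<Sum>k<n. \<Sum>j<n. (a * ?\<omega> k) ^ j) = (\<Sum>j<n. a ^ j * (\<Sum>k<n. ?\<omega> k ^ j))"
    by (subst sum.swap) (simp add: power_mult_distrib sum_distrib_left)
  also have "\<dots> = (\<Sum>j<n. if j = 0 then of_nat n else 0)"
    by (intro sum.cong) (auto simp: sum_power_root_unity)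
  also have "\<dots> = of_nat n"
    using assms(1) by (simp add: sum.delta)
  finally show ?thesis by (simp add: geom flip: sum_divide_distrib)
qed

text \<open>For z = a cis t, Re (1 / (1 - z)) = (1 - Re z) / |1 - z|^2, and 2 (1 - Re z) - |1 - z|^2
  = 1 - |z|^2.\<close>

lemma Poisson_kernel_eq_Re:
  fixes a t :: real
  assumes "\<bar>a\<bar> < 1"
  shows "(1 - a\<^sup>2) / (1 - 2 * a * cos t + a\<^sup>2) = 2 * Re (1 / (1 - of_real a * cis t)) - 1"
proof -
  have norm: "(1 - a * cos t)\<^sup>2 + (a * sin t)\<^sup>2 = 1 - 2 * a * cos t + a\<^sup>2"
    using sin_cos_squared_add[of t] by algebra
  \<comment> \<open>The denominator is nonzero because already the first square in
    \<open>norm\<close> is.\<close>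
  have "\<bar>a * cos t\<bar> \<le> \<bar>a\<bar>"
    using mult_left_mono[OF abs_cos_le_one, of "\<bar>a\<bar>" t] by (simp add: abs_mult)
  with assms have "1 - a * cos t \<noteq> 0" by linarith
  then have ne: "1 - 2 * a * cos t + a\<^sup>2 \<noteq> 0"
    unfolding norm[symmetric] by (simp add: sum_power2_eq_zero_iff)
  have "Re (1 / (1 - of_real a * cis t)) = (1 - a * cos t) / (1 - 2 * a * cos t + a\<^sup>2)"
    by (simp add: Re_divide norm)
  then show ?thesis using ne by (simp add: field_simps)
qed

theorem theorem3p2:
  fixes n :: nat
  assumes "n > 0"
  shows "(\<Sum>k = 0..n - 1. 1 / (1 + 2 * (sin (real k * pi / real n))\<^sup>2))
       = real n / sqrt 3 * (2 / (1 - (2 - sqrt 3) ^ n) - 1)"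
proof -
  define a where "a = 2 - sqrt 3"
  let ?\<omega> = "\<lambda>k. cis (2 * pi * real k / real n)"
  have "sqrt 3 < 2" "1 < sqrt 3" by (auto intro: real_less_lsqrt)
  then have a: "0 < a" "a < 1" by (auto simp: a_def)
  \<comment> \<open>These give the kernel's numerator and denominator the common factor 2 a, leaving
    sqrt 3 / (2 - cos t).\<close>
  have quad: "1 + a\<^sup>2 = 4 * a" "1 - a\<^sup>2 = 2 * a * sqrt 3"
    by (simp_all add: a_def power2_eq_square algebra_simps)
  have pow: "a ^ n < 1" using a assms by (simp add: power_Suc_less_one power_less_one_iff)
  have summand: "1 / (1 + 2 * (sin (real k * pi / real n))\<^sup>2)
      = (2 * Re (1 / (1 - of_real a * ?\<omega> k)) - 1) / sqrt 3" for k
  proof -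
    let ?t = "2 * pi * real k / real n"
    have "1 + 2 * (sin (real k * pi / real n))\<^sup>2 = 2 - cos ?t"
      using cos_double_sin[of "real k * pi / real n"] by (simp add: mult_ac)
    moreover have "1 - 2 * a * cos ?t + a\<^sup>2 = 2 * a * (2 - cos ?t)"
      using quad(1) by (simp add: algebra_simps)
    moreover have "2 * Re (1 / (1 - of_real a * ?\<omega> k)) - 1
        = (1 - a\<^sup>2) / (1 - 2 * a * cos ?t + a\<^sup>2)"
      using a by (intro Poisson_kernel_eq_Re[symmetric]) simp
    ultimately show ?thesis using a quad(2) by simp
  qed
  have "(of_real a :: complex) ^ n \<noteq> 1"
    using pow by (metis less_irrefl of_real_eq_1_iff of_real_power)
  then have "(\<Sum>k<n. 1 / (1 - of_real a * ?\<omega> k)) = of_nat n / (1 - of_real a ^ n)"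
    by (rule sum_inverse_one_minus_root_unity[OF assms])
  also have "\<dots> = of_real (real n / (1 - a ^ n))" by simp
  finally have Re_sum: "(\<Sum>k<n. Re (1 / (1 - of_real a * ?\<omega> k))) = real n / (1 - a ^ n)"
    by (metis Re_sum Re_complex_of_real)
  \<comment> \<open>Positivity of n matters: for n = 0 truncated subtraction would make the left
    side {0}.\<close>
  have "{0..n - 1} = {..<n}" using assms by auto
  then have "(\<Sum>k = 0..n - 1. 1 / (1 + 2 * (sin (real k * pi / real n))\<^sup>2))
      = (2 * (\<Sum>k<n. Re (1 / (1 - of_real a * ?\<omega> k))) - real n) / sqrt 3"
    unfolding summand by (simp add: sum_subtractf sum_distrib_left flip: sum_divide_distrib)
  also have "\<dots> = real n / sqrt 3 * (2 / (1 - a ^ n) - 1)"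
    unfolding Re_sum by (simp add: algebra_simps diff_divide_distrib)
  finally show ?thesis by (simp add: a_def)
qed

end
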